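(* For each fixed integer $\sigma\ge1$, $$G_\sigma(n)\sim\frac{e\,((\sigma+1)n)!}{n!\,((\sigma+1)!)^n}\quad\text{as } n\to\infty.$$
   Context: Gift exchange game with steal limit $\sigma\ge 0$ and $m\ge 1$ gifts: there are $m$ players and $m$ distinct wrapped gifts, initially all in a pool. The players are called one at a time in a fixed order. When a player is called, and also whenever a player's gift has just been stolen, that player (who currently holds no gift) makes a move: either take one of the gifts still in the pool (it is unwrapped and held by that player), or steal an unwrapped gift currently held by another player, provided this gift has so far been stolen fewer than $\sigma$ times in total; the player from whom it was stolen then immediately makes a move. The game ends as soon as the last gift in the pool is taken. A scenario is the complete sequence of moves (which player took which gift at each move). For $n\ge 0$, $G_\sigma(n)$ is the number of scenarios of the game with $m=n+1$ gifts in which the gifts are taken from the pool in the order $1,2,\ldots,n+1$. *)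

theory Defs
  imports Complex_Main "HOL-Library.Landau_Symbols"
begin

type_synonym player = nat
type_synonym gift = nat

text \<open>Players are numbered in the order in which they are called: 1, 2, 3, and so on.
  Player \<open>called s\<close> is the last one called so far, and \<open>mover s\<close> is the
  player whose turn it is (either just called, or just robbed).\<close>

record state =
  pool :: "gift set"
  holder :: "gift \<Rightarrow> player option"
  steals :: "gift \<Rightarrow> nat"
  called :: player
  mover :: player

definition initial :: "nat \<Rightarrow> state" where
  "initial m = \<lparr>pool = {1..m}, holder = (\<lambda>_. None), steals = (\<lambda>_. 0), called = 1, mover = 1\<rparr>"

text \<open>After a gift is taken from the pool the next player is called.  When the pool has
  just become empty the game is over and \<open>called\<close>, \<open>mover\<close> are meaningless.\<close>

definition take_from_pool :: "gift \<Rightarrow> state \<Rightarrow> state" where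
  "take_from_pool g s = s\<lparr>pool := pool s - {g}, holder := (holder s)(g \<mapsto> mover s),
     called := called s + 1, mover := called s + 1\<rparr>"

definition steal_from :: "player \<Rightarrow> gift \<Rightarrow> state \<Rightarrow> state" where
  "steal_from q g s = s\<lparr>holder := (holder s)(g \<mapsto> mover s),
     steals := (steals s)(g := steals s g + 1), mover := q\<rparr>"

text \<open>\<open>play \<sigma> s ms\<close>: from state \<open>s\<close> the sequence of moves \<open>ms\<close> is legal and
  leads exactly to the end of the game.  A move \<open>(p, g)\<close> says that player \<open>p\<close> took
  gift \<open>g\<close>.\<close>

inductive play :: "nat \<Rightarrow> state \<Rightarrow> (player \<times> gift) list \<Rightarrow> bool" for \<sigma> :: nat where
  over: "pool s = {} \<Longrightarrow> play \<sigma> s []"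
| take: "g \<in> pool s \<Longrightarrow> play \<sigma> (take_from_pool g s) ms \<Longrightarrow> play \<sigma> s ((mover s, g) # ms)"
| steal: "pool s \<noteq> {} \<Longrightarrow> holder s g = Some q \<Longrightarrow> q \<noteq> mover s \<Longrightarrow> steals s g < \<sigma> \<Longrightarrow>
    play \<sigma> (steal_from q g s) ms \<Longrightarrow> play \<sigma> s ((mover s, g) # ms)"

definition scenarios :: "nat \<Rightarrow> nat \<Rightarrow> (player \<times> gift) list set" where
  "scenarios \<sigma> m = {ms. play \<sigma> (initial m) ms}"

text \<open>The gifts taken from the pool, in order, where \<open>P\<close> is the pool at the start of the
  sequence of moves.\<close>

fun pool_order :: "gift set \<Rightarrow> (player \<times> gift) list \<Rightarrow> gift list" where
  "pool_order P [] = []"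
| "pool_order P ((p, g) # ms) =
    (if g \<in> P then g # pool_order (P - {g}) ms else pool_order P ms)"

definition G :: "nat \<Rightarrow> nat \<Rightarrow> nat" where
  "G \<sigma> n = card {ms \<in> scenarios \<sigma> (n + 1). pool_order {1..n + 1} ms = [1..<n + 2]}"

end

theory Submission
  imports Defs "HOL-Computational_Algebra.Polynomial" "HOL-Analysis.Uniform_Limit"
begin

text \<open>A scenario is determined by the sequence of gifts taken, which is an arbitrary word over
  \<open>1, \<dots>, n\<close> with first occurrences in this order and each letter used between 1 and
  \<open>s = \<sigma> + 1\<close> times, followed by the gift \<open>n + 1\<close>.  So these words encode partitions of
  \<open>{1..k}\<close> into \<open>n\<close> blocks of size at most \<open>s\<close>, and by the exponential formula the number of
  words of length \<open>k\<close> is \<open>k! / n!\<close> times the coefficient of \<open>x\<^sup>k\<close> in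
  \<open>(x / 1! + \<dots> + x\<^sup>s / s!)\<^sup>n\<close>.  The longest words, \<open>k = s n\<close>, contribute
  \<open>(s n)! / (n! s!\<^sup>n)\<close>; relative to this the words of length \<open>s n - j\<close> contribute
  \<open>1 / j!\<close> in the limit, because almost all of them omit one occurrence of \<open>j\<close> different letters.
  As the contribution is dominated by \<open>s\<^bsup>2j\<^esup> / j!\<close>, Tannery's theorem gives the factor \<open>e\<close>.\<close>

subsection \<open>Scenarios as words\<close>

text \<open>The effect of \<open>pool_order\<close> on the gift components alone: players can be
  forgotten, because they are recoverable from the gifts.\<close>

fun first_occs :: "'a set \<Rightarrow> 'a list \<Rightarrow> 'a list" where
  "first_occs P [] = []"
| "first_occs P (g # u) = (if g \<in> P then g # first_occs (P - {g}) u else first_occs P u)"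

lemma first_occs_filter: "x \<notin> P \<Longrightarrow> first_occs P (filter (\<lambda>y. y \<noteq> x) u) = first_occs P u"
  by (induction P u rule: first_occs.induct) auto

text \<open>\<open>c g\<close> is the number of times an unwrapped gift \<open>g\<close> may still be stolen, and \<open>ps\<close> are
  the gifts to be unwrapped, except for the last one.\<close>

definition words :: "nat \<Rightarrow> ('a \<Rightarrow> nat) \<Rightarrow> 'a list \<Rightarrow> 'a list set" where
  "words \<sigma> c ps = {u. first_occs (set ps) u = ps \<and>
     (\<forall>g. count_list u g \<le> c g + (if g \<in> set ps then \<sigma> + 1 else 0))}"

lemma Nil_in_words_iff: "[] \<in> words \<sigma> c ps \<longleftrightarrow> ps = []"
  by (auto simp: words_def)

text \<open>A new gift must be the next one due. As \<open>c\<close> vanishes on \<open>ps\<close>,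
  its total allowance is \<open>\<sigma> + 1\<close>, and this first use leaves
  \<open>\<sigma>\<close>.\<close>

lemma Cons_in_words_fresh:
  assumes "g \<in> set ps" "distinct ps" "\<forall>p\<in>set ps. c p = 0"
  shows "g # u \<in> words \<sigma> c ps \<longleftrightarrow>
    (\<exists>ps'. ps = g # ps' \<and> u \<in> words \<sigma> (c(g := \<sigma>)) ps')"
proof (cases ps)
  case (Cons p ps')
  show ?thesis
  proof (cases "g = p")
    case True
    have "set ps - {g} = set ps'" using Cons True assms(2) by auto
    moreover have "g \<notin> set ps'" "c g = 0" using Cons True assms by auto
    ultimately show ?thesis
      using Cons True by (auto simp: words_def split: if_splits)
  qed (use Cons assms in \<open>auto simp: words_def\<close>)
qed (use assms in auto)

text \<open>Repeating a letter affects no first occurrence; it only uses up one of the remaining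
  steals.\<close>

lemma Cons_in_words_old:
  assumes "g \<notin> set ps"
  shows "g # u \<in> words \<sigma> c ps \<longleftrightarrow> 0 < c g \<and> u \<in> words \<sigma> (c(g := c g - 1)) ps"
  using assms by (fastforce simp: words_def split: if_splits)

section \<open>Correspondence between plays and words\<close>

text \<open>The argument \<open>c\<close> of \<open>words\<close> belonging to a state. Wrapped
  gifts get 0, because \<open>words\<close> grants them \<open>\<sigma> + 1\<close>
  separately.\<close>

definition cap :: "nat \<Rightarrow> state \<Rightarrow> gift \<Rightarrow> nat" where
  "cap \<sigma> s g = (if holder s g = None then 0 else \<sigma> - steals s g)"

text \<open>Invariant of play that makes taking from the pool and stealing mutually exclusive for a
  given gift.\<close>

definition pool_free :: "state \<Rightarrow> bool" where
  "pool_free s \<longleftrightarrow> (\<forall>g\<in>pool s. holder s g = None \<and> steals s g = 0)"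

lemma pool_free_take: "pool_free s \<Longrightarrow> pool_free (take_from_pool g s)"
  by (auto simp: pool_free_def take_from_pool_def)

lemma pool_free_steal: "pool_free s \<Longrightarrow> holder s g = Some q \<Longrightarrow> pool_free (steal_from q g s)"
  by (auto simp: pool_free_def steal_from_def)

lemma cap_take: "pool_free s \<Longrightarrow> g \<in> pool s \<Longrightarrow> cap \<sigma> (take_from_pool g s) = (cap \<sigma> s)(g := \<sigma>)"
  by (auto simp: pool_free_def take_from_pool_def cap_def)

lemma cap_steal:
  "holder s g = Some q \<Longrightarrow> cap \<sigma> (steal_from q g s) = (cap \<sigma> s)(g := cap \<sigma> s g - 1)"
  by (auto simp: steal_from_def cap_def)

lemma cap_pool: "pool_free s \<Longrightarrow> g \<in> pool s \<Longrightarrow> cap \<sigma> s g = 0"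
  by (auto simp: pool_free_def cap_def)

lemma pool_take [simp]: "pool (take_from_pool g s) = pool s - {g}"
  by (simp add: take_from_pool_def)

lemma pool_steal [simp]: "pool (steal_from q g s) = pool s"
  by (simp add: steal_from_def)

lemma play_empty_pool: "play \<sigma> s ms \<Longrightarrow> pool s = {} \<Longrightarrow> ms = []"
  by (auto elim: play.cases)

text \<open>Each move prepends a letter: a take is governed by \<open>Cons_in_words_fresh\<close>, a
  steal by \<open>Cons_in_words_old\<close>. The last gift \<open>l\<close> stays outside the word,
  since taking it ends the game.\<close>

lemma play_imp_word:
  assumes "play \<sigma> s ms" "pool_free s" "pool s = set (ps @ [l])" "distinct (ps @ [l])"
    "pool_order (pool s) ms = ps @ [l]"
  shows "\<exists>u\<in>words \<sigma> (cap \<sigma> s) ps. map snd ms = u @ [l]"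
  using assms
proof (induction arbitrary: ps rule: play.induct)
  case (over s)
  then show ?case by simp
next
  case (take g s ms)
  show ?case
  proof (cases ps)
    \<comment> \<open>Only \<open>l\<close> is left in the pool, so this take empties it and no move
      can follow.\<close>
    case Nil
    with take have "g = l" "pool s = {l}" by auto
    then have "ms = []" using take.hyps(2) by (auto intro: play_empty_pool)
    then show ?thesis using \<open>g = l\<close> Nil by (auto simp: Nil_in_words_iff)
  next
    case (Cons p ps')
    with take have gp: "g = p" by auto
    have "pool (take_from_pool g s) = set (ps' @ [l])"
      using take.prems Cons gp by auto
    moreover have "pool_order (pool (take_from_pool g s)) ms = ps' @ [l]"
      using take.prems take.hyps Cons gp by auto
    moreover have "distinct (ps' @ [l])" using take.prems Cons by simp
    ultimately obtain u where u: "u \<in> words \<sigma> (cap \<sigma> (take_from_pool g s)) ps'" "map snd ms = u @ [l]"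
      using take.IH take.prems(1) pool_free_take by blast
    then have "g # u \<in> words \<sigma> (cap \<sigma> s) ps"
      using Cons gp take.prems cap_pool[OF take.prems(1)]
      unfolding cap_take[OF take.prems(1) take.hyps(1)]
      by (subst Cons_in_words_fresh) auto
    then show ?thesis using u(2) by (intro bexI[of _ "g # u"]) auto
  qed
next
  case (steal s g q ms)
  have np: "g \<notin> pool s" using steal by (auto simp: pool_free_def)
  obtain u where u: "u \<in> words \<sigma> (cap \<sigma> (steal_from q g s)) ps" "map snd ms = u @ [l]"
    using steal.IH[of ps, unfolded pool_steal] pool_free_steal[OF steal.prems(1) steal.hyps(2)]
      steal.prems np by auto
  have "0 < cap \<sigma> s g" using steal.hyps by (simp add: cap_def)
  then have "g # u \<in> words \<sigma> (cap \<sigma> s) ps"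
    using u(1) steal.prems(2) np
    by (subst Cons_in_words_old) (auto simp only: cap_steal[OF steal.hyps(2)] set_append)
  then show ?case using u(2) by (intro bexI[of _ "g # u"]) auto
qed

text \<open>Makes the condition that the thief is not the current holder automatic: the player to move
  is empty-handed.\<close>

definition mover_free :: "state \<Rightarrow> bool" where
  "mover_free s \<longleftrightarrow> (\<forall>g. holder s g \<noteq> Some (mover s)) \<and> mover s \<le> called s \<and>
     (\<forall>g q. holder s g = Some q \<longrightarrow> q \<le> called s) \<and>
     (\<forall>g h q. holder s g = Some q \<longrightarrow> holder s h = Some q \<longrightarrow> g = h)"

text \<open>The player called next has a number above those of all holders, hence is
  empty-handed.\<close>

lemma mover_free_take: "mover_free s \<Longrightarrow> mover_free (take_from_pool g s)"
  unfolding mover_free_def take_from_pool_def by (fastforce simp: le_Suc_eq split: if_splits)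

text \<open>The robbed player \<open>q\<close> moves next and is empty-handed, because
  \<open>g\<close> was the only gift of \<open>q\<close>.\<close>

lemma mover_free_steal: "mover_free s \<Longrightarrow> holder s g = Some q \<Longrightarrow> mover_free (steal_from q g s)"
  unfolding mover_free_def steal_from_def by (auto split: if_splits)

text \<open>Reading the word letter by letter dictates the moves: letters in \<open>ps\<close> are
  taken from the pool, all others are stolen, and \<open>l\<close> is taken at the end.\<close>

lemma word_imp_play:
  assumes "u \<in> words \<sigma> (cap \<sigma> s) ps" "pool_free s" "mover_free s"
    "pool s = set (ps @ [l])" "distinct (ps @ [l])"
  shows "\<exists>ms. play \<sigma> s ms \<and> pool_order (pool s) ms = ps @ [l] \<and> map snd ms = u @ [l]"
  using assms
proof (induction u arbitrary: s ps)
  case Nil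
  then have "ps = []" by (simp add: Nil_in_words_iff)
  then show ?case using Nil
    by (intro exI[of _ "[(mover s, l)]"]) (auto intro!: play.intros)
next
  case (Cons g u)
  consider "g \<in> set ps" | "g \<notin> set ps" by blast
  then show ?case
  proof cases
    case 1
    obtain ps' where ps': "ps = g # ps'" "u \<in> words \<sigma> ((cap \<sigma> s)(g := \<sigma>)) ps'"
      using Cons.prems 1 cap_pool by (subst (asm) Cons_in_words_fresh) auto
    have g: "g \<in> pool s" using 1 Cons.prems by simp
    have pool: "pool s - {g} = set (ps' @ [l])" using Cons.prems ps' by auto
    obtain ms where ms: "play \<sigma> (take_from_pool g s) ms" "map snd ms = u @ [l]"
      "pool_order (pool (take_from_pool g s)) ms = ps' @ [l]"
      using Cons.IH[of "take_from_pool g s" ps', unfolded cap_take[OF Cons.prems(2) g] pool_take, OF ps'(2)]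
        pool_free_take[OF Cons.prems(2)] mover_free_take[OF Cons.prems(3)] pool Cons.prems(5) ps'(1)
      by auto
    have "play \<sigma> s ((mover s, g) # ms)" using g ms(1) by (rule play.take)
    then show ?thesis using g ps' ms by (intro exI[of _ "(mover s, g) # ms"]) auto
  next
    case 2
    \<comment> \<open>Positive capacity yields a holder and a permitted steal, and it excludes
      \<open>g = l\<close>, as gifts in the pool have capacity 0.\<close>
    then have w: "0 < cap \<sigma> s g" "u \<in> words \<sigma> ((cap \<sigma> s)(g := cap \<sigma> s g - 1)) ps"
      using Cons.prems(1) by (auto simp: Cons_in_words_old)
    then obtain q where q: "holder s g = Some q" "steals s g < \<sigma>"
      by (auto simp: cap_def split: if_splits)
    have g: "g \<notin> pool s" using w(1) cap_pool Cons.prems(2) by fastforce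
    have "q \<noteq> mover s" using q Cons.prems(3) by (auto simp: mover_free_def)
    obtain ms where ms: "play \<sigma> (steal_from q g s) ms" "map snd ms = u @ [l]"
      "pool_order (pool s) ms = ps @ [l]"
      using Cons.IH[of "steal_from q g s" ps, unfolded cap_steal[OF q(1)] pool_steal, OF w(2)]
        pool_free_steal[OF Cons.prems(2) q(1)] mover_free_steal[OF Cons.prems(3) q(1)] Cons.prems(4,5)
      by auto
    have "play \<sigma> s ((mover s, g) # ms)"
      using Cons.prems(4) q \<open>q \<noteq> mover s\<close> ms(1) by (intro play.steal) auto
    then show ?thesis using g ms by (intro exI[of _ "(mover s, g) # ms"]) auto
  qed
qed

text \<open>The state fixes who moves, and membership of the gift in the pool fixes the kind of
  move, so the successor state is determined too.\<close>

lemma play_determined_by_gifts: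
  assumes "play \<sigma> s ms" "play \<sigma> s ms'" "pool_free s" "map snd ms = map snd ms'"
  shows "ms = ms'"
  using assms
proof (induction arbitrary: ms' rule: play.induct)
  case (take g s ms)
  from take.prems(3) obtain p r where ms': "ms' = (p, g) # r" by (cases ms') auto
  from take.prems(1)[unfolded ms'] show ?case
  proof cases
    case take
    then show ?thesis using take.IH[of r] take.prems take.hyps ms' pool_free_take by auto
  next
    case steal
    then show ?thesis using take.prems take.hyps by (auto simp: pool_free_def)
  qed
next
  case (steal s g q ms)
  from steal.prems(3) obtain p r where ms': "ms' = (p, g) # r" by (cases ms') auto
  from steal.prems(1)[unfolded ms'] show ?case
  proof cases
    case take
    then show ?thesis using steal.prems steal.hyps by (auto simp: pool_free_def)
  next
    case (steal q')
    then show ?thesis using steal.IH[of r] steal.prems steal.hyps ms' pool_free_steal by auto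
  qed
qed auto

text \<open>Forgetting the players and removing the final gift \<open>n + 1\<close> are both
  injective, which gives a bijection between scenarios and words.\<close>

lemma G_eq_card_words: "G \<sigma> n = card (words \<sigma> (\<lambda>_. 0) [1..<Suc n])"
proof -
  define S where "S = {ms \<in> scenarios \<sigma> (n + 1). pool_order {1..n + 1} ms = [1..<n + 2]}"
  let ?i = "initial (n + 1)" and ?ps = "[1..<Suc n]" and ?l = "Suc n"
  have split: "[1..<n + 2] = ?ps @ [?l]" by simp
  have init: "pool_free ?i" "mover_free ?i" "cap \<sigma> ?i = (\<lambda>_. 0)" "pool ?i = set (?ps @ [?l])"
    "pool ?i = {1..n + 1}"
    by (auto simp: pool_free_def mover_free_def initial_def cap_def)
  have d: "distinct (?ps @ [?l])" by simp
  have S: "ms \<in> S \<longleftrightarrow> play \<sigma> ?i ms \<and> pool_order (pool ?i) ms = ?ps @ [?l]" for ms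
    unfolding S_def scenarios_def init(5) split by simp
  have "map snd ` S = (\<lambda>u. u @ [?l]) ` words \<sigma> (\<lambda>_. 0) ?ps"
  proof (intro equalityI subsetI; elim imageE)
    fix w ms assume "w = map snd ms" "ms \<in> S"
    then show "w \<in> (\<lambda>u. u @ [?l]) ` words \<sigma> (\<lambda>_. 0) ?ps"
      using play_imp_word[OF _ init(1) init(4) d, of \<sigma> ms, unfolded init(3)] unfolding S by blast
  next
    fix w u assume w: "w = u @ [?l]" "u \<in> words \<sigma> (\<lambda>_. 0) ?ps"
    then obtain ms where "ms \<in> S" "map snd ms = w"
      using word_imp_play[of u \<sigma> ?i ?ps ?l, unfolded init(3), OF _ init(1,2,4) d] unfolding S by blast
    then show "w \<in> map snd ` S" by blast
  qed
  moreover have "inj_on (map snd) S"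
    by (intro inj_onI) (use play_determined_by_gifts init(1) in \<open>auto simp: S\<close>)
  moreover have "inj_on (\<lambda>u. u @ [?l]) (words \<sigma> (\<lambda>_. 0) ?ps)"
    by (auto intro: inj_onI)
  ultimately show ?thesis
    unfolding G_def S_def[symmetric] by (metis card_image)
qed

subsection \<open>Counting words\<close>

lemma set_word_subset: "u \<in> words \<sigma> (\<lambda>_. 0) xs \<Longrightarrow> set u \<subseteq> set xs"
proof
  fix g assume "u \<in> words \<sigma> (\<lambda>_. 0) xs" "g \<in> set u"
  then have "count_list u g \<le> (if g \<in> set xs then \<sigma> + 1 else 0)" "count_list u g \<noteq> 0"
    by (auto simp: words_def count_list_0_iff)
  then show "g \<in> set xs" by (auto split: if_splits)
qed

lemma length_word_bounds:
  assumes "u \<in> words \<sigma> (\<lambda>_. 0) xs" "distinct xs"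
  shows "length u \<le> (\<sigma> + 1) * length xs" "length xs \<le> length u"
proof -
  have "length u = (\<Sum>x\<in>set xs. count_list u x)"
    using sum_count_set[OF set_word_subset[OF assms(1)]] by simp
  also have "count_list u x \<le> \<sigma> + 1" if "x \<in> set xs" for x
    using assms(1) that unfolding words_def by (auto dest: spec[of _ x])
  then have "(\<Sum>x\<in>set xs. count_list u x) \<le> (\<Sum>x\<in>set xs. \<sigma> + 1)"
    by (rule sum_mono)
  finally show "length u \<le> (\<sigma> + 1) * length xs"
    using assms(2) by (simp add: distinct_card mult.commute)
  have "length (first_occs P u) \<le> length u" for P
    by (induction P u rule: first_occs.induct) auto
  from this[of "set xs"] show "length xs \<le> length u"
    using assms(1) by (simp add: words_def)
qed

definition words_len :: "nat \<Rightarrow> 'a list \<Rightarrow> nat \<Rightarrow> 'a list set" where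
  "words_len \<sigma> xs k = {u \<in> words \<sigma> (\<lambda>_. 0) xs. length u = k}"

lemma finite_words_len: "finite (words_len \<sigma> xs k)"
proof (rule finite_subset)
  show "words_len \<sigma> xs k \<subseteq> {u. set u \<subseteq> set xs \<and> length u = k}"
    using set_word_subset by (fastforce simp: words_len_def)
qed (simp add: finite_lists_length_eq)

text \<open>Each gift is unwrapped once, so the excess \<open>m\<close> of the length over the
  number of gifts is the total number of steals.\<close>

lemma card_words_eq_sum:
  assumes "distinct xs"
  shows "card (words \<sigma> (\<lambda>_. 0) xs) =
    (\<Sum>m\<le>\<sigma> * length xs. card (words_len \<sigma> xs (length xs + m)))"
proof -
  have "words \<sigma> (\<lambda>_. 0) xs = (\<Union>m\<in>{..\<sigma> * length xs}. words_len \<sigma> xs (length xs + m))"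
  proof (intro equalityI subsetI)
    fix u assume u: "u \<in> words \<sigma> (\<lambda>_. 0) xs"
    then show "u \<in> (\<Union>m\<in>{..\<sigma> * length xs}. words_len \<sigma> xs (length xs + m))"
      using length_word_bounds[OF u assms]
      by (intro UN_I[of "length u - length xs"]) (auto simp: words_len_def)
  qed (auto simp: words_len_def)
  also have "card \<dots> = (\<Sum>m\<le>\<sigma> * length xs. card (words_len \<sigma> xs (length xs + m)))"
    by (rule card_UN_disjoint) (auto simp: finite_words_len, auto simp: words_len_def)
  finally show ?thesis .
qed

section \<open>Recursion on the first letter\<close>

text \<open>Splits a word uniquely into its copies of \<open>x\<close> and the rest, so that
  shuffles can count the ways of inserting \<open>x\<close>.\<close>

lemma in_shuffles_replicate_iff:
  assumes "x \<notin> set v"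
  shows "u \<in> shuffles (replicate i x) v \<longleftrightarrow> count_list u x = i \<and> filter (\<lambda>y. y \<noteq> x) u = v"
proof
  assume u: "u \<in> shuffles (replicate i x) v"
  have d: "set v \<inter> set (replicate i x) = {}" using assms by auto
  have "u \<in> shuffles v (replicate i x)" using u by (simp add: shuffles_commutes)
  from filter_shuffles_disjoint1[OF d this]
  have a: "filter (\<lambda>y. y \<in> set v) u = v" "filter (\<lambda>y. y \<notin> set v) u = replicate i x" .
  have "set u = set (replicate i x) \<union> set v" using u by (rule set_shuffles)
  then have "y \<in> set v \<longleftrightarrow> y \<noteq> x" if "y \<in> set u" for y
    using assms that by (auto split: if_splits)
  then have "filter (\<lambda>y. y \<noteq> x) u = filter (\<lambda>y. y \<in> set v) u"
    "filter (\<lambda>y. x = y) u = filter (\<lambda>y. y \<notin> set v) u"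
    by (auto intro!: filter_cong)
  then have "filter (\<lambda>y. y \<noteq> x) u = v" "filter (\<lambda>y. x = y) u = replicate i x"
    using a by simp_all
  then show "count_list u x = i \<and> filter (\<lambda>y. y \<noteq> x) u = v"
    by (simp add: count_list_eq_length_filter)
next
  assume u: "count_list u x = i \<and> filter (\<lambda>y. y \<noteq> x) u = v"
  then have "filter (\<lambda>y. x = y) u = replicate i x"
    by (metis count_list_eq_length_filter replicate_length_filter)
  moreover have "filter (\<lambda>y. \<not> x = y) u = v" using u by (simp add: eq_commute[of x])
  ultimately show "u \<in> shuffles (replicate i x) v"
    using partition_in_shuffles[of u "\<lambda>y. x = y"] by simp
qed

lemma count_list_filter_neq: "count_list (filter (\<lambda>y. y \<noteq> x) u) g = (if g = x then 0 else count_list u g)"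
  by (induction u) auto

lemma length_filter_neq: "length u = count_list u x + length (filter (\<lambda>y. y \<noteq> x) u)"
  by (induction u) auto

text \<open>Copies of a gift that is already unwrapped may stand anywhere, and deleting them changes
  no condition on the other letters.\<close>

lemma words_spare_letter:
  assumes "x \<notin> set xs"
  shows "u \<in> words \<sigma> ((\<lambda>_. 0)(x := \<sigma>)) xs \<longleftrightarrow>
    count_list u x \<le> \<sigma> \<and> filter (\<lambda>y. y \<noteq> x) u \<in> words \<sigma> (\<lambda>_. 0) xs"
proof -
  let ?b = "\<lambda>g. if g \<in> set xs then \<sigma> + 1 else 0"
  have "(\<forall>g. count_list u g \<le> ((\<lambda>_. 0)(x := \<sigma>)) g + ?b g) \<longleftrightarrow>
      count_list u x \<le> \<sigma> \<and> (\<forall>g. (if g = x then 0 else count_list u g) \<le> 0 + ?b g)"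
  proof -
    have *: "(\<forall>g. A g) \<longleftrightarrow> B \<and> (\<forall>g. C g)"
      if "A x \<longleftrightarrow> B" "C x" "\<And>g. g \<noteq> x \<Longrightarrow> A g \<longleftrightarrow> C g" for A C :: "'a \<Rightarrow> bool" and B
      using that by metis
    show ?thesis by (rule *) (use assms in simp_all)
  qed
  then show ?thesis
    unfolding words_def mem_Collect_eq first_occs_filter[OF assms] count_list_filter_neq by blast
qed

text \<open>The first letter is forced to be \<open>x\<close>. If \<open>i\<close> more copies of
  \<open>x\<close> follow, their places are chosen among the \<open>k\<close> remaining ones, and
  the other letters form a word over \<open>xs\<close>.\<close>

lemma card_words_len_Cons:
  assumes "distinct (x # xs)"
  shows "card (words_len \<sigma> (x # xs) (Suc k)) =
    (\<Sum>i | i \<le> \<sigma> \<and> i \<le> k. (k choose i) * card (words_len \<sigma> xs (k - i)))"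
proof -
  let ?I = "{i. i \<le> \<sigma> \<and> i \<le> k}"
  let ?S = "\<lambda>(i, v). shuffles (replicate i x) v"
  define J where "J = (SIGMA i:?I. words_len \<sigma> xs (k - i))"
  have x: "x \<notin> set xs" using assms by simp
  have xv: "x \<notin> set v" if "(i, v) \<in> J" for i v
    using that set_word_subset[of v \<sigma> xs] x by (auto simp: J_def words_len_def)
  have "words_len \<sigma> (x # xs) (Suc k) = (#) x ` (\<Union>j\<in>J. ?S j)"
  proof (intro equalityI subsetI)
    fix w assume w: "w \<in> words_len \<sigma> (x # xs) (Suc k)"
    then obtain g u where gu: "w = g # u" by (cases w) (auto simp: words_len_def)
    have "g \<in> set (x # xs)" using w gu set_word_subset[of w \<sigma> "x # xs"] by (auto simp: words_len_def)
    then have g: "g = x" and u: "u \<in> words \<sigma> ((\<lambda>_. 0)(x := \<sigma>)) xs"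
      using w gu Cons_in_words_fresh[of g "x # xs" "\<lambda>_. 0" u \<sigma>] assms by (auto simp: words_len_def)
    let ?i = "count_list u x" and ?v = "filter (\<lambda>y. y \<noteq> x) u"
    have len: "length u = k" using w gu by (simp add: words_len_def)
    have "?i \<le> \<sigma>" "?v \<in> words \<sigma> (\<lambda>_. 0) xs" using u words_spare_letter[OF x] by auto
    then have "(?i, ?v) \<in> J" using length_filter_neq[of u x] len by (auto simp: J_def words_len_def)
    moreover have "u \<in> shuffles (replicate ?i x) ?v" by (subst in_shuffles_replicate_iff) auto
    ultimately show "w \<in> (#) x ` (\<Union>j\<in>J. ?S j)" using gu g by auto
  next
    fix w assume "w \<in> (#) x ` (\<Union>j\<in>J. ?S j)"
    then obtain u i v where w: "w = x # u" "(i, v) \<in> J" "u \<in> shuffles (replicate i x) v" by auto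
    then have u: "count_list u x = i" "filter (\<lambda>y. y \<noteq> x) u = v"
      using in_shuffles_replicate_iff[OF xv[OF w(2)]] by auto
    then have "u \<in> words \<sigma> ((\<lambda>_. 0)(x := \<sigma>)) xs" "length u = k"
      using w(2) words_spare_letter[OF x] length_filter_neq[of u x] by (auto simp: J_def words_len_def)
    then show "w \<in> words_len \<sigma> (x # xs) (Suc k)"
      using w(1) Cons_in_words_fresh[of x "x # xs" "\<lambda>_. 0" u \<sigma>] assms by (auto simp: words_len_def)
  qed
  then have "card (words_len \<sigma> (x # xs) (Suc k)) = card (\<Union>j\<in>J. ?S j)"
    by (simp add: card_image)
  also have "\<dots> = (\<Sum>j\<in>J. card (?S j))"
  proof (rule card_UN_disjoint)
    show "finite J" by (auto simp: J_def finite_words_len)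
    \<comment> \<open>A shuffle determines \<open>i\<close> as its number of \<open>x\<close> and
      \<open>v\<close> as what remains without \<open>x\<close>.\<close>
    show "\<forall>a\<in>J. \<forall>b\<in>J. a \<noteq> b \<longrightarrow> ?S a \<inter> ?S b = {}"
      using xv by (auto simp: in_shuffles_replicate_iff)
  qed auto
  also have "\<dots> = (\<Sum>(i, v)\<in>J. k choose i)"
  proof (intro sum.cong refl, clarify)
    fix i v assume iv: "(i, v) \<in> J"
    have "card (shuffles (replicate i x) v) = (i + length v) choose i"
      using xv[OF iv] by (subst card_disjoint_shuffles) auto
    moreover have "i + length v = k" using iv by (auto simp: J_def words_len_def)
    ultimately show "card (shuffles (replicate i x) v) = k choose i" by simp
  qed
  also have "\<dots> = (\<Sum>i\<in>?I. \<Sum>v\<in>words_len \<sigma> xs (k - i). k choose i)"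
    unfolding J_def by (rule sum.Sigma[symmetric]) (auto simp: finite_words_len)
  finally show ?thesis by (simp add: mult.commute)
qed

section \<open>Exponential generating function\<close>

text \<open>The exponential generating function of one block of size 1 to
  \<open>\<sigma> + 1\<close>, divided by \<open>X\<close>: exponents count steals, and
  \<open>pCons 0\<close> restores the factor \<open>X\<close>.\<close>

definition block_poly :: "nat \<Rightarrow> real poly" where
  "block_poly \<sigma> = (\<Sum>i\<le>\<sigma>. monom (1 / fact (Suc i)) i)"

lemma coeff_block_poly: "coeff (block_poly \<sigma>) i = (if i \<le> \<sigma> then 1 / fact (Suc i) else 0)"
  unfolding block_poly_def coeff_sum by simp

lemma degree_block_poly: "degree (block_poly \<sigma>) = \<sigma>"
  by (intro antisym degree_le le_degree) (auto simp: coeff_block_poly)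

lemma block_poly_nonzero: "block_poly \<sigma> \<noteq> 0"
  using coeff_block_poly[of \<sigma> 0] by auto

text \<open>Differentiating the exponential generating function \<open>p\<^sup>n / n!\<close> singles out the block of the
  first letter, so its coefficients satisfy the recursion just found.\<close>

lemma card_words_len:
  assumes "distinct xs"
  shows "real (card (words_len \<sigma> xs k)) * fact (length xs) / fact k =
    coeff (pCons 0 (block_poly \<sigma>) ^ length xs) k"
  using assms
proof (induction xs arbitrary: k)
  case Nil
  have "words_len \<sigma> ([] :: 'a list) k = (if k = 0 then {[]} else {})"
    using set_word_subset[of _ \<sigma> "[]"] by (auto simp: words_len_def Nil_in_words_iff)
  then show ?case by simp
next
  case (Cons x xs)
  let ?p = "pCons 0 (block_poly \<sigma>)" and ?n = "length xs"
  show ?case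
  proof (cases k)
    case 0
    have "words_len \<sigma> (x # xs) 0 = {}" by (auto simp: words_len_def Nil_in_words_iff)
    then show ?thesis using 0 by (simp add: coeff_mult)
  next
    case (Suc k')
    \<comment> \<open>The derivative is the truncated exponential series: it generates the
      \<open>i \<le> \<sigma>\<close> companions of the first letter in its block.\<close>
    have dp: "coeff (pderiv ?p) i = (if i \<le> \<sigma> then 1 / fact i else 0)" for i
      by (simp add: coeff_pderiv coeff_block_poly fact_Suc del: of_nat_Suc)
    have "real (Suc k') * coeff (?p ^ Suc ?n) (Suc k') = coeff (pderiv (?p ^ Suc ?n)) k'"
      by (simp only: coeff_pderiv)
    also have "pderiv (?p ^ Suc ?n) = smult (real (Suc ?n)) (pderiv ?p * ?p ^ ?n)"
      unfolding pderiv_power_Suc by (simp add: mult.commute)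
    also have "coeff \<dots> k' = real (Suc ?n) *
        (\<Sum>i\<le>k'. (if i \<le> \<sigma> then 1 / fact i else 0) * coeff (?p ^ ?n) (k' - i))"
      by (simp only: coeff_smult coeff_mult dp)
    also have "(\<Sum>i\<le>k'. (if i \<le> \<sigma> then 1 / fact i else 0) * coeff (?p ^ ?n) (k' - i)) =
        (\<Sum>i | i \<le> \<sigma> \<and> i \<le> k'. 1 / fact i * coeff (?p ^ ?n) (k' - i))"
      by (rule sum.mono_neutral_cong_right) auto
    also have "\<dots> = (\<Sum>i | i \<le> \<sigma> \<and> i \<le> k'.
        real ((k' choose i) * card (words_len \<sigma> xs (k' - i))) * (fact ?n / fact k'))"
    \<comment> \<open>The induction hypothesis turns the convolution into the binomial sum of
      \<open>card_words_len_Cons\<close>.\<close>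
    proof (rule sum.cong[OF refl])
      fix i assume "i \<in> {i. i \<le> \<sigma> \<and> i \<le> k'}"
      then have "real (k' choose i) = fact k' / (fact i * fact (k' - i))"
        by (simp add: binomial_fact)
      moreover have "coeff (?p ^ ?n) (k' - i) =
          real (card (words_len \<sigma> xs (k' - i))) * fact ?n / fact (k' - i)"
        using Cons by simp
      ultimately show "1 / fact i * coeff (?p ^ ?n) (k' - i) =
          real ((k' choose i) * card (words_len \<sigma> xs (k' - i))) * (fact ?n / fact k')"
        by simp
    qed
    also have "\<dots> = real (card (words_len \<sigma> (x # xs) (Suc k'))) * (fact ?n / fact k')"
      unfolding card_words_len_Cons[OF Cons.prems] of_nat_sum sum_distrib_right ..
    finally have "real (Suc k') * coeff (?p ^ Suc ?n) (Suc k') =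
      real (Suc ?n) * (real (card (words_len \<sigma> (x # xs) (Suc k'))) * (fact ?n / fact k'))" .
    then show ?thesis unfolding Suc
      by (simp add: field_simps del: of_nat_Suc power_Suc)
  qed
qed

text \<open>Splitting off \<open>X ^ n\<close>, one obligatory letter per block, moves coefficient
  \<open>n + m\<close> to coefficient \<open>m\<close>, the number of steals.\<close>

lemma G_eq_sum_coeff:
  "fact n * real (G \<sigma> n) = (\<Sum>m\<le>\<sigma> * n. fact (n + m) * coeff (block_poly \<sigma> ^ n) m)"
proof -
  have "pCons 0 (block_poly \<sigma>) ^ n = monom 1 n * block_poly \<sigma> ^ n"
    by (simp add: monom_altdef flip: power_mult_distrib)
  then have "coeff (pCons 0 (block_poly \<sigma>) ^ n) (n + m) = coeff (block_poly \<sigma> ^ n) m" for m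
    by (simp add: coeff_monom_mult)
  then have "fact n * real (card (words_len \<sigma> [1..<Suc n] (n + m))) =
      fact (n + m) * coeff (block_poly \<sigma> ^ n) m" for m
    using card_words_len[of "[1..<Suc n]" \<sigma> "n + m"] by (simp add: field_simps del: upt_Suc)
  then show ?thesis
    using card_words_eq_sum[of "[1..<Suc n]" \<sigma>]
    by (simp add: G_eq_card_words sum_distrib_left del: upt_Suc)
qed

subsection \<open>Asymptotics\<close>

text \<open>After reversal the exponent counts the letters missing from a word of maximal length.
  The scaling makes the constant coefficient 1, and the other coefficients are falling factorials of
  \<open>\<sigma> + 1\<close>.\<close>

definition reverse_poly :: "nat \<Rightarrow> real poly" where
  "reverse_poly \<sigma> = smult (fact (\<sigma> + 1)) (reflect_poly (block_poly \<sigma>))"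

lemma coeff_reverse_poly:
  "coeff (reverse_poly \<sigma>) i = (if i \<le> \<sigma> then fact (\<sigma> + 1) / fact (\<sigma> + 1 - i) else 0)"
  by (simp add: reverse_poly_def coeff_reflect_poly degree_block_poly coeff_block_poly Suc_diff_le)

text \<open>All \<open>j\<close> factors of the falling factorial \<open>N! / (N - j)!\<close>
  exceed \<open>n\<close>. This later provides the domination.\<close>

lemma fact_ge_power_mult: "n + j \<le> N \<Longrightarrow> real n ^ j * fact (N - j) \<le> fact N"
proof (induction j)
  case (Suc j)
  have "real n ^ Suc j * fact (N - Suc j) \<le> real n ^ j * (real (N - j) * fact (N - Suc j))"
    using Suc.prems mult_left_mono[of "real n" "real (N - j)" "real n ^ j * fact (N - Suc j)"]
    by (simp add: mult_ac)
  also have "real (N - j) * fact (N - Suc j) = fact (N - j)"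
    using Suc.prems by (subst (2) fact_reduce) auto
  finally show ?case using Suc by simp
qed simp

lemma coeff_reverse_poly_bounds:
  "0 \<le> coeff (reverse_poly \<sigma>) i" "coeff (reverse_poly \<sigma>) i \<le> real (\<sigma> + 1) ^ i"
proof -
  show "0 \<le> coeff (reverse_poly \<sigma>) i" by (simp add: coeff_reverse_poly)
  have "(fact (\<sigma> + 1) :: real) \<le> real (\<sigma> + 1) ^ i * fact (\<sigma> + 1 - i)" if "i \<le> \<sigma>"
    using that
  proof (induction i)
    case (Suc i)
    have "(fact (\<sigma> + 1) :: real) \<le> real (\<sigma> + 1) ^ i * fact (\<sigma> + 1 - i)" using Suc by simp
    also have "(fact (\<sigma> + 1 - i) :: real) = real (\<sigma> + 1 - i) * fact (\<sigma> + 1 - Suc i)"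
      using Suc.prems by (subst fact_reduce) auto
    also have "\<dots> \<le> real (\<sigma> + 1) * fact (\<sigma> + 1 - Suc i)"
      by (intro mult_right_mono) auto
    finally show ?case by (simp add: mult_ac)
  qed simp
  then show "coeff (reverse_poly \<sigma>) i \<le> real (\<sigma> + 1) ^ i"
    by (auto simp: coeff_reverse_poly divide_le_eq)
qed

text \<open>The hockey-stick identity: compare coefficients in
  \<open>(1 - X)^(-a) * (1 - X)^(-1) = (1 - X)^(-(a + 1))\<close>.\<close>

lemma sum_pochhammer:
  fixes a :: real
  shows "(\<Sum>i\<le>j. pochhammer a i / fact i) = pochhammer (a + 1) j / fact j"
proof (induction j)
  case (Suc j)
  have "pochhammer (a + 1) j / fact j + pochhammer a (Suc j) / fact (Suc j) =
      pochhammer (a + 1) j * (real (Suc j) + a) / fact (Suc j)"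
    by (simp add: pochhammer_rec add_divide_distrib distrib_left mult_ac fact_Suc del: of_nat_Suc)
  then show ?case using Suc by (simp add: pochhammer_rec' mult_ac add_ac)
qed simp

text \<open>Coefficientwise, \<open>1 + s X \<le> reverse_poly \<le> 1 / (1 - s X)\<close> with \<open>s = \<sigma> + 1\<close>.\<close>

lemma coeff_reverse_poly_power_bounds:
  assumes "\<sigma> \<ge> 1"
  shows "real (\<sigma> + 1) ^ j * real (n choose j) \<le> coeff (reverse_poly \<sigma> ^ n) j"
    and "coeff (reverse_poly \<sigma> ^ n) j \<le> real (\<sigma> + 1) ^ j * (pochhammer (real n) j / fact j)"
proof -
  let ?R = "reverse_poly \<sigma>" and ?s = "real (\<sigma> + 1)"
  have nonneg: "0 \<le> coeff (?R ^ n) j" for n j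
    by (induction n arbitrary: j) (auto simp: coeff_mult intro!: sum_nonneg mult_nonneg_nonneg coeff_reverse_poly_bounds)
  show "?s ^ j * real (n choose j) \<le> coeff (?R ^ n) j"
  proof (induction n arbitrary: j)
    case 0
    then show ?case by (cases j) auto
  next
    case (Suc n)
    \<comment> \<open>The linear coefficient is present because
      \<open>\<sigma> \<ge> 1\<close>.\<close>
    have R0: "coeff ?R 0 = 1" and R1: "coeff ?R 1 = ?s"
      using assms by (auto simp: coeff_reverse_poly fact_Suc)
    show ?case
    proof (cases j)
      case 0
      then show ?thesis using Suc[of 0] by (simp add: coeff_mult R0)
    next
      case (Suc j')
      \<comment> \<open>Pascal's rule matches the two lowest terms of the convolution; the others
        are nonnegative and may be dropped.\<close>
      have "?s ^ j * real (Suc n choose j) = 1 * (?s ^ j * real (n choose j)) + ?s * (?s ^ j' * real (n choose j'))"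
        using Suc by (simp add: algebra_simps)
      also have "\<dots> \<le> 1 * coeff (?R ^ n) j + ?s * coeff (?R ^ n) j'"
        by (intro add_mono mult_left_mono Suc.IH) auto
      also have "\<dots> = (\<Sum>i\<in>{0, 1}. coeff ?R i * coeff (?R ^ n) (j - i))"
        using Suc R0 R1 by simp
      also have "\<dots> \<le> (\<Sum>i\<le>j. coeff ?R i * coeff (?R ^ n) (j - i))"
        using Suc by (intro sum_mono2) (auto intro!: mult_nonneg_nonneg coeff_reverse_poly_bounds nonneg)
      finally show ?thesis by (simp add: coeff_mult)
    qed
  qed
  show "coeff (?R ^ n) j \<le> ?s ^ j * (pochhammer (real n) j / fact j)"
  proof (induction n arbitrary: j)
    case 0
    then show ?case by (cases j) (auto simp: pochhammer_0_left)
  next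
    case (Suc n)
    \<comment> \<open>Bounding the new factor by the geometric series lets the powers of
      \<open>?s\<close> combine to \<open>?s ^ j\<close>, leaving a hockey-stick sum.\<close>
    have "coeff (?R ^ Suc n) j \<le> (\<Sum>i\<le>j. ?s ^ i * (?s ^ (j - i) * (pochhammer (real n) (j - i) / fact (j - i))))"
      unfolding power_Suc coeff_mult
      by (intro sum_mono mult_mono Suc.IH coeff_reverse_poly_bounds nonneg) auto
    also have "\<dots> = ?s ^ j * (\<Sum>i\<le>j. pochhammer (real n) (j - i) / fact (j - i))"
      unfolding sum_distrib_left
      by (intro sum.cong refl) (simp flip: power_add mult.assoc)
    also have "(\<Sum>i\<le>j. pochhammer (real n) (j - i) / fact (j - i)) = (\<Sum>i\<le>j. pochhammer (real n) i / fact i)"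
      by (rule sum.nat_diff_reindex[of "\<lambda>i. pochhammer (real n) i / fact i" "Suc j", unfolded lessThan_Suc_atMost, simplified])
    also have "\<dots> = pochhammer (real (Suc n)) j / fact j"
      by (simp add: sum_pochhammer add_ac)
    finally show ?case .
  qed
qed

text \<open>Substitute \<open>m = \<sigma> * n - j\<close> in \<open>G_eq_sum_coeff\<close>; since
  \<open>block_poly \<sigma> ^ n\<close> has degree \<open>\<sigma> * n\<close>, its reversal has
  just these coefficients.\<close>

lemma G_eq_sum_reverse:
  "fact n * fact (\<sigma> + 1) ^ n * real (G \<sigma> n) =
    (\<Sum>j\<le>\<sigma> * n. fact ((\<sigma> + 1) * n - j) * coeff (reverse_poly \<sigma> ^ n) j)"
proof -
  have coeff: "coeff (reverse_poly \<sigma> ^ n) j = fact (\<sigma> + 1) ^ n * coeff (block_poly \<sigma> ^ n) (\<sigma> * n - j)"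
    if "j \<le> \<sigma> * n" for j
  proof -
    have "degree (block_poly \<sigma> ^ n) = \<sigma> * n"
      by (simp add: degree_power_eq block_poly_nonzero degree_block_poly)
    then show ?thesis
      using that by (simp add: reverse_poly_def smult_power coeff_reflect_poly flip: reflect_poly_power)
  qed
  have "fact n * real (G \<sigma> n) =
      (\<Sum>j\<le>\<sigma> * n. fact (n + (\<sigma> * n - j)) * coeff (block_poly \<sigma> ^ n) (\<sigma> * n - j))"
    unfolding G_eq_sum_coeff
    by (rule sum.reindex_bij_witness[of _ "\<lambda>j. \<sigma> * n - j" "\<lambda>j. \<sigma> * n - j"]) auto
  then have "fact n * fact (\<sigma> + 1) ^ n * real (G \<sigma> n) = fact (\<sigma> + 1) ^ n *
      (\<Sum>j\<le>\<sigma> * n. fact (n + (\<sigma> * n - j)) * coeff (block_poly \<sigma> ^ n) (\<sigma> * n - j))"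
    by (simp add: mult_ac)
  also have "\<dots> = (\<Sum>j\<le>\<sigma> * n. fact ((\<sigma> + 1) * n - j) * coeff (reverse_poly \<sigma> ^ n) j)"
    unfolding sum_distrib_left by (intro sum.cong refl) (simp add: coeff mult_ac)
  finally show ?thesis .
qed

section \<open>Limits and domination of the terms\<close>

lemma prod_linear_over_power_tendsto:
  fixes c :: real and d :: "nat \<Rightarrow> real"
  shows "(\<lambda>n. (\<Prod>i<j. c * real n + d i) / real n ^ j) \<longlonglongrightarrow> c ^ j"
proof -
  have lim: "(\<lambda>n. c + d i * inverse (real n)) \<longlonglongrightarrow> c + d i * 0" for i
    by (intro tendsto_intros lim_inverse_n)
  have "(\<lambda>n. \<Prod>i<j. c + d i * inverse (real n)) \<longlonglongrightarrow> (\<Prod>i<j. c)"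
    using lim by (intro tendsto_prod) simp
  then have "(\<lambda>n. \<Prod>i<j. c + d i * inverse (real n)) \<longlonglongrightarrow> c ^ j" by simp
  moreover have "\<forall>\<^sub>F n in sequentially.
      (\<Prod>i<j. c + d i * inverse (real n)) = (\<Prod>i<j. c * real n + d i) / real n ^ j"
    using eventually_gt_at_top[of 0]
  proof eventually_elim
    case (elim n)
    have "(\<Prod>i<j. c + d i * inverse (real n)) = (\<Prod>i<j. (c * real n + d i) / real n)"
      using elim by (intro prod.cong refl) (simp add: field_simps)
    then show ?case by (simp add: prod_dividef)
  qed
  ultimately show ?thesis by (rule Lim_transform_eventually)
qed

text \<open>The falling factorial, shaped to fit \<open>prod_linear_over_power_tendsto\<close>. For
  \<open>j > N\<close> both sides vanish.\<close>

lemma binomial_prod: "fact j * real (N choose j) = (\<Prod>i<j. real N + - real i)"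
  by (simp add: binomial_gbinomial gbinomial_prod_rev lessThan_atLeast0)

text \<open>Both bounds on the coefficient grow like \<open>(s * n)^j / j!\<close> with
  \<open>s = \<sigma> + 1\<close>, and the quotient of factorials decays like
  \<open>1 / (s * n)^j\<close>.\<close>

lemma ratio_tendsto:
  assumes "\<sigma> \<ge> 1"
  shows "(\<lambda>n. coeff (reverse_poly \<sigma> ^ n) j * fact ((\<sigma> + 1) * n - j) / fact ((\<sigma> + 1) * n))
    \<longlonglongrightarrow> 1 / fact j"
proof -
  let ?s = "real (\<sigma> + 1)"
  \<comment> \<open>Over \<open>n ^ j\<close>, \<open>A (-1)\<close> is the falling and
    \<open>A 1\<close> the rising factorial of \<open>n\<close>; \<open>B\<close> is the falling
    factorial of \<open>?s * n\<close>.\<close>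
  define A where "A d n = (\<Prod>i<j. 1 * real n + d * real i) / real n ^ j" for d n
  define B where "B n = (\<Prod>i<j. ?s * real n + - real i) / real n ^ j" for n
  have A: "A d \<longlonglongrightarrow> 1" for d
    using prod_linear_over_power_tendsto[where c = 1 and d = "\<lambda>i. d * real i"] by (simp add: A_def[abs_def])
  have B: "B \<longlonglongrightarrow> ?s ^ j"
    unfolding B_def by (rule prod_linear_over_power_tendsto)
  have lim: "(\<lambda>n. ?s ^ j / fact j * A d n / B n) \<longlonglongrightarrow> 1 / fact j" for d
  proof -
    have "(\<lambda>n. ?s ^ j / fact j * A d n / B n) \<longlonglongrightarrow> ?s ^ j / fact j * 1 / ?s ^ j"
      by (intro tendsto_intros A B) simp
    then show ?thesis by simp
  qed
  \<comment> \<open>This permits division by \<open>n ^ j\<close> and keeps the subtraction inside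
    the factorial from being truncated.\<close>
  have ev: "\<forall>\<^sub>F n in sequentially. n > 0 \<and> j \<le> (\<sigma> + 1) * n"
  proof (rule eventually_mono[OF eventually_ge_at_top[of "Suc j"]])
    fix n assume "Suc j \<le> n"
    then show "n > 0 \<and> j \<le> (\<sigma> + 1) * n" by (auto simp: add.commute intro: trans_le_add1)
  qed
  have ratio: "fact ((\<sigma> + 1) * n - j) / fact ((\<sigma> + 1) * n) = 1 / (B n * real n ^ j)"
    if "n > 0 \<and> j \<le> (\<sigma> + 1) * n" for n
  proof -
    have "B n * real n ^ j = fact j * real ((\<sigma> + 1) * n choose j)"
      using that unfolding binomial_prod B_def of_nat_mult by simp
    also have "\<dots> = fact ((\<sigma> + 1) * n) / fact ((\<sigma> + 1) * n - j)"
      using that by (subst binomial_fact) auto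
    finally show ?thesis by simp
  qed
  show ?thesis
  proof (rule tendsto_sandwich[OF _ _ lim[of "-1"] lim[of 1]])
    show "\<forall>\<^sub>F n in sequentially. ?s ^ j / fact j * A (-1) n / B n \<le>
        coeff (reverse_poly \<sigma> ^ n) j * fact ((\<sigma> + 1) * n - j) / fact ((\<sigma> + 1) * n)"
      using ev
    proof eventually_elim
      case (elim n)
      have "A (-1) n * real n ^ j = fact j * real (n choose j)"
        using elim by (simp add: A_def binomial_prod)
      then have a: "A (-1) n = fact j * real (n choose j) / real n ^ j"
        using elim by (simp add: field_simps)
      have "?s ^ j / fact j * A (-1) n / B n =
          ?s ^ j * real (n choose j) * (fact ((\<sigma> + 1) * n - j) / fact ((\<sigma> + 1) * n))"
        unfolding ratio[OF elim] a by simp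
      also have "\<dots> \<le> coeff (reverse_poly \<sigma> ^ n) j * (fact ((\<sigma> + 1) * n - j) / fact ((\<sigma> + 1) * n))"
        by (intro mult_right_mono coeff_reverse_poly_power_bounds(1)[OF assms]) simp
      finally show ?case by simp
    qed
    show "\<forall>\<^sub>F n in sequentially.
        coeff (reverse_poly \<sigma> ^ n) j * fact ((\<sigma> + 1) * n - j) / fact ((\<sigma> + 1) * n)
        \<le> ?s ^ j / fact j * A 1 n / B n"
      using ev
    proof eventually_elim
      case (elim n)
      have "A 1 n * real n ^ j = pochhammer (real n) j"
        using elim by (simp add: A_def pochhammer_prod lessThan_atLeast0)
      then have a: "A 1 n = pochhammer (real n) j / real n ^ j"
        using elim by (simp add: field_simps)
      have "coeff (reverse_poly \<sigma> ^ n) j * (fact ((\<sigma> + 1) * n - j) / fact ((\<sigma> + 1) * n)) \<le>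
          ?s ^ j * (pochhammer (real n) j / fact j) * (fact ((\<sigma> + 1) * n - j) / fact ((\<sigma> + 1) * n))"
        by (intro mult_right_mono coeff_reverse_poly_power_bounds(2)[OF assms]) simp
      also have "\<dots> = ?s ^ j / fact j * A 1 n / B n"
        unfolding ratio[OF elim] a by simp
      finally show ?case by simp
    qed
  qed
qed

text \<open>For \<open>j \<le> \<sigma> n\<close> the rising factorial is at most \<open>(s n)\<^sup>j\<close> and the falling
  factorial of \<open>s n\<close> is at least \<open>n\<^sup>j\<close>, where \<open>s = \<sigma> + 1\<close>.\<close>

lemma ratio_bound:
  assumes "\<sigma> \<ge> 1" "j \<le> \<sigma> * n"
  shows "\<bar>coeff (reverse_poly \<sigma> ^ n) j * fact ((\<sigma> + 1) * n - j) / fact ((\<sigma> + 1) * n)\<bar>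
    \<le> (real (\<sigma> + 1) ^ 2) ^ j / fact j"
proof -
  let ?s = "real (\<sigma> + 1)"
  have "pochhammer (real n) j = (\<Prod>i<j. real n + real i)"
    by (simp add: pochhammer_prod lessThan_atLeast0)
  also have "\<dots> \<le> (\<Prod>i<j. ?s * real n)"
  proof (intro prod_mono conjI)
    fix i assume "i \<in> {..<j}"
    then have "n + i \<le> (\<sigma> + 1) * n" using assms(2) by simp
    then show "real n + real i \<le> ?s * real n" by (metis of_nat_add of_nat_le_iff of_nat_mult)
  qed simp
  finally have poch: "pochhammer (real n) j \<le> ?s ^ j * real n ^ j"
    by (simp add: power_mult_distrib)
  have pos: "0 \<le> coeff (reverse_poly \<sigma> ^ n) j"
    by (rule order_trans[OF _ coeff_reverse_poly_power_bounds(1)[OF assms(1)]]) simp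
  have "coeff (reverse_poly \<sigma> ^ n) j * fact ((\<sigma> + 1) * n - j) \<le>
      ?s ^ j * ((?s ^ j * real n ^ j) / fact j) * fact ((\<sigma> + 1) * n - j)"
    by (intro mult_right_mono order_trans[OF coeff_reverse_poly_power_bounds(2)[OF assms(1)]]
        mult_left_mono divide_right_mono poch) auto
  also have "\<dots> = (?s ^ 2) ^ j / fact j * (real n ^ j * fact ((\<sigma> + 1) * n - j))"
    by (simp add: power2_eq_square power_mult_distrib)
  also have "\<dots> \<le> (?s ^ 2) ^ j / fact j * fact ((\<sigma> + 1) * n)"
    using assms(2) by (intro mult_left_mono fact_ge_power_mult) auto
  finally show ?thesis using pos by (simp add: divide_le_eq)
qed

theorem theorem4:
  fixes \<sigma> :: nat
  assumes "\<sigma> \<ge> 1"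
  shows "(\<lambda>n. real (G \<sigma> n)) \<sim>[at_top]
    (\<lambda>n. exp 1 * fact ((\<sigma> + 1) * n) / (fact n * fact (\<sigma> + 1) ^ n))"
proof -
  \<comment> \<open>Extension by 0 beyond \<open>\<sigma> * n\<close> turns the finite sums into
    series over all \<open>j\<close>.\<close>
  define a where "a j n = (if j \<le> \<sigma> * n then
    coeff (reverse_poly \<sigma> ^ n) j * fact ((\<sigma> + 1) * n - j) / fact ((\<sigma> + 1) * n) else 0)" for j n
  \<comment> \<open>The majorant from \<open>ratio_bound\<close> does not depend on
    \<open>n\<close>; it sums to the exponential of \<open>(\<sigma> + 1) ^ 2\<close>.\<close>
  define M where "M j = (real (\<sigma> + 1) ^ 2) ^ j / fact j" for j
  have "a j \<longlonglongrightarrow> 1 / fact j" for j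
  proof (rule Lim_transform_eventually[OF ratio_tendsto[OF assms]])
    show "\<forall>\<^sub>F n in sequentially. coeff (reverse_poly \<sigma> ^ n) j * fact ((\<sigma> + 1) * n - j) /
        fact ((\<sigma> + 1) * n) = a j n"
      \<comment> \<open>For \<open>n \<ge> j\<close>, \<open>\<sigma> \<ge> 1\<close> gives
        \<open>j \<le> \<sigma> * n\<close>, so the default value 0 no longer occurs.\<close>
      using eventually_ge_at_top[of j]
    proof eventually_elim
      case (elim n)
      have "j \<le> \<sigma> * n" using elim mult_le_mono[OF assms elim] by simp
      then show ?case by (simp add: a_def)
    qed
  qed
  moreover have "norm (a j n) \<le> M j" for j n
    using ratio_bound[OF assms, of j n] by (simp add: a_def M_def)
  then have "\<forall>\<^sub>F (j, n) in at_top \<times>\<^sub>F sequentially. norm (a j n) \<le> M j"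
    by (intro always_eventually) auto
  moreover have "summable M"
    using summable_exp[of "real (\<sigma> + 1) ^ 2"] by (simp add: M_def[abs_def] divide_inverse mult.commute)
  ultimately have "(\<lambda>n. \<Sum>j. a j n) \<longlonglongrightarrow> (\<Sum>j. 1 / fact j)"
    using tannerys_theorem[of a "\<lambda>j. 1 / fact j" sequentially M] by simp
  also have "(\<Sum>j. 1 / fact j) = exp (1 :: real)"
    by (simp add: exp_def inverse_eq_divide)
  also have "(\<lambda>n. \<Sum>j. a j n) =
      (\<lambda>n. fact n * fact (\<sigma> + 1) ^ n * real (G \<sigma> n) / fact ((\<sigma> + 1) * n))"
  proof
    fix n
    have "(\<Sum>j. a j n) = (\<Sum>j\<le>\<sigma> * n. a j n)"
      by (rule suminf_finite) (auto simp: a_def)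
    also have "\<dots> = (\<Sum>j\<le>\<sigma> * n. fact ((\<sigma> + 1) * n - j) * coeff (reverse_poly \<sigma> ^ n) j) /
        fact ((\<sigma> + 1) * n)"
      unfolding sum_divide_distrib by (intro sum.cong refl) (simp add: a_def)
    finally show "(\<Sum>j. a j n) = fact n * fact (\<sigma> + 1) ^ n * real (G \<sigma> n) / fact ((\<sigma> + 1) * n)"
      by (simp only: G_eq_sum_reverse)
  qed
  \<comment> \<open>Dividing by \<open>exp 1\<close> produces the quotient of the two sides, whose
    limit 1 is the asymptotic equivalence.\<close>
  finally have "(\<lambda>n. fact n * fact (\<sigma> + 1) ^ n * real (G \<sigma> n) / fact ((\<sigma> + 1) * n) / exp 1)
      \<longlonglongrightarrow> exp 1 / exp 1"
    by (intro tendsto_divide tendsto_const) auto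
  then show ?thesis
    by (intro asymp_equivI') (simp add: mult_ac)
qed

end
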